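(* Let $\delta,\beta\in(0,1)$, let $K\ge 1$, and let $R^{(0)},R^{(1)},\ldots,R^{(K)}$ be independent and identically distributed random variables with distribution $\mathbb{P}\in\mathcal{P}(\mathcal{X})$. Let the radius $r_K(\beta)>0$ be chosen so that $$\mathbb{P}^K\bigl(W_\infty(\widehat{\mathbb{P}}_K,\mathbb{P})\le r_K(\beta)\bigr)\ge 1-\beta,$$ and define $$\bar\alpha_{\mathrm{DRO}}:=\mathrm{Quantile}_{1-\delta}(R^{(1)},\ldots,R^{(K)})+r_K(\beta).$$ Then $$\mathbb{P}^K\Bigl(\mathbb{P}\bigl(R^{(0)}\le\bar\alpha_{\mathrm{DRO}}\bigr)\ge 1-\delta\Bigr)\ge 1-\beta,$$ where the inner probability is over $R^{(0)}$ with the calibration samples fixed and the outer one is over $R^{(1)},\ldots,R^{(K)}$. Moreover, for every realization of the calibration sample $R^{(1)},\ldots,R^{(K)}$, $$\inf_{\mathbb{Q}\in\mathcal{M}^{r_K(\beta)}(\widehat{\mathbb{P}}_K)}\mathbb{Q}\bigl(R^{(0)}\le\bar\alpha_{\mathrm{DRO}}\bigr)\ge 1-\delta.$$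
   Context: $\mathcal{X}\subseteq\mathbb{R}$ with its Borel $\sigma$-algebra, and $\mathcal{P}(\mathcal{X})$ is the set of Borel probability measures on $\mathcal{X}$. $\mathbb{P}^K=\mathbb{P}^{\otimes K}$ is the law of the i.i.d. calibration sample $R^{(1)},\ldots,R^{(K)}$. For values $a_1,\ldots,a_n$ and $p\in(0,1)$, $\mathrm{Quantile}_p(a_1,\ldots,a_n)$ is the $\lceil np\rceil$-th smallest of them. $\widehat{\mathbb{P}}_K=\frac1K\sum_{i=1}^K\delta_{R^{(i)}}$ is the empirical distribution ($\delta_x$ the Dirac mass at $x$). For $\mathbb{P}_1,\mathbb{P}_2\in\mathcal{P}(\mathcal{X})$, $\Gamma(\mathbb{P}_1,\mathbb{P}_2)$ is the set of couplings (joint distributions on $\mathcal{X}\times\mathcal{X}$ with these marginals), and $$W_\infty(\mathbb{P}_1,\mathbb{P}_2):=\inf_{\pi\in\Gamma(\mathbb{P}_1,\mathbb{P}_2)}\ \sup_{(x_1,x_2)\in\operatorname{supp}(\pi)}|x_1-x_2|.$$ The ambiguity set is $\mathcal{M}^{r}(\widehat{\mathbb{P}}_K):=\{\mathbb{Q}\in\mathcal{P}(\mathcal{X}): W_\infty(\mathbb{Q},\widehat{\mathbb{P}}_K)\le r\}$. For $\mathbb{Q}\in\mathcal{P}(\mathcal{X})$ and a number $a$, $\mathbb{Q}(R^{(0)}\le a)$ means the probability that a random variable with law $\mathbb{Q}$ is at most $a$, i.e. the $\mathbb{Q}$-mass of $(-\infty,a]$, with the calibration sample held fixed. *)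

theory Defs
  imports "HOL-Probability.Probability"
begin

definition borel_on :: "real set \<Rightarrow> real measure" where
  "borel_on X = restrict_space borel X"

definition prob_measures :: "real set \<Rightarrow> real measure set" where
  "prob_measures X = space (prob_algebra (borel_on X))"

definition sample_law ::
    "'w measure \<Rightarrow> real set \<Rightarrow> nat \<Rightarrow> (nat \<Rightarrow> 'w \<Rightarrow> real) \<Rightarrow> (nat \<Rightarrow> real) measure" where
  "sample_law M X K R = distr M (\<Pi>\<^sub>M i\<in>{1..K}. borel_on X) (\<lambda>\<omega>. \<lambda>i\<in>{1..K}. R i \<omega>)"

text \<open>For an i.i.d. sample, the law is the product measure.\<close>

lemma sample_law_iid:
  assumes "prob_space M" and "K \<ge> 1"
    and ind: "prob_space.indep_vars M (\<lambda>_. borel_on X) R {0..K}"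
    and dis: "\<forall>i\<in>{0..K}. distr M (borel_on X) (R i) = P"
  shows "sample_law M X K R = (\<Pi>\<^sub>M i\<in>{1..K}. P)"
proof -
  interpret prob_space M by fact
  have ind1: "indep_vars (\<lambda>_. borel_on X) R {1..K}"
    using ind by (rule indep_vars_subset) auto
  have rv: "\<And>i. i \<in> {1..K} \<Longrightarrow> random_variable (borel_on X) (R i)"
    using ind1 by (auto simp: indep_vars_def)
  have "{1..K} \<noteq> {}" using \<open>K \<ge> 1\<close> by auto
  then have "sample_law M X K R = (\<Pi>\<^sub>M i\<in>{1..K}. distr M (borel_on X) (R i))"
    using indep_vars_iff_distr_eq_PiM'[where I = "{1..K}" and M' = "\<lambda>_. borel_on X" and X = R, OF _ rv] ind1
    unfolding sample_law_def by blast
  also have "\<dots> = (\<Pi>\<^sub>M i\<in>{1..K}. P)"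
    using dis by (intro PiM_cong) auto
  finally show ?thesis .
qed

text \<open>A realization of the sample \<open>R\<^sup>1, \<dots>, R\<^sup>K\<close> is a function \<open>x\<close> on the indices \<open>1, \<dots>, K\<close>.\<close>

definition empirical :: "real set \<Rightarrow> nat \<Rightarrow> (nat \<Rightarrow> real) \<Rightarrow> real measure" where
  "empirical X K x = measure_of X (sets (borel_on X))
     (\<lambda>A. (\<Sum>i\<in>{1..K}. emeasure (return (borel_on X) (x i)) A) / of_nat K)"

text \<open>\<open>measure_of\<close> falls back to the null measure if its argument is not countably additive;
  this does not happen here.\<close>

lemma emeasure_empirical:
  assumes "A \<in> sets (borel_on X)"
  shows "emeasure (empirical X K x) A
    = (\<Sum>i\<in>{1..K}. emeasure (return (borel_on X) (x i)) A) / of_nat K"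
proof (rule emeasure_measure_of[OF empirical_def])
  let ?\<mu> = "\<lambda>A. (\<Sum>i\<in>{1..K}. emeasure (return (borel_on X) (x i)) A) / (of_nat K :: ennreal)"
  have sp: "space (borel_on X) = X" by (simp add: borel_on_def space_restrict_space)
  show "sets (borel_on X) \<subseteq> Pow X"
    using sets.space_closed[of "borel_on X"] sp by simp
  have se: "sets (empirical X K x) = sets (borel_on X)"
    unfolding empirical_def using sets.sigma_sets_eq[of "borel_on X"] sets.space_closed[of "borel_on X"]
    by (simp add: sp sets_measure_of)
  show "A \<in> sets (empirical X K x)" using assms se by simp
  show "positive (sets (empirical X K x)) ?\<mu>" by (simp add: positive_def)
  show "countably_additive (sets (empirical X K x)) ?\<mu>"
    unfolding se
  proof (rule countably_additiveI)
    fix B :: "nat \<Rightarrow> real set"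
    assume B: "range B \<subseteq> sets (borel_on X)" "disjoint_family B"
    have "(\<Sum>n. ?\<mu> (B n)) = (\<Sum>n. \<Sum>i\<in>{1..K}. emeasure (return (borel_on X) (x i)) (B n)) / of_nat K"
      by (simp add: divide_ennreal_def ennreal_suminf_multc)
    also have "\<dots> = (\<Sum>i\<in>{1..K}. \<Sum>n. emeasure (return (borel_on X) (x i)) (B n)) / of_nat K"
      by (subst suminf_sum) auto
    also have "\<dots> = ?\<mu> (\<Union>n. B n)"
      using B by (subst suminf_emeasure) auto
    finally show "(\<Sum>n. ?\<mu> (B n)) = ?\<mu> (\<Union>n. B n)" .
  qed
qed

definition couplings :: "real set \<Rightarrow> real measure \<Rightarrow> real measure \<Rightarrow> (real \<times> real) measure set" where
  "couplings X P1 P2 = {\<pi> \<in> space (prob_algebra (borel_on X \<Otimes>\<^sub>M borel_on X)).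
     distr \<pi> (borel_on X) fst = P1 \<and> distr \<pi> (borel_on X) snd = P2}"

text \<open>The support is taken in the subspace \<open>space \<pi>\<close>.\<close>

definition msupp :: "'a::topological_space measure \<Rightarrow> 'a set" where
  "msupp \<pi> = {z \<in> space \<pi>. \<forall>U. open U \<and> z \<in> U \<longrightarrow> emeasure \<pi> (U \<inter> space \<pi>) > 0}"

definition W_infty :: "real set \<Rightarrow> real measure \<Rightarrow> real measure \<Rightarrow> ereal" where
  "W_infty X P1 P2 = (INF \<pi>\<in>couplings X P1 P2. SUP (x1, x2)\<in>msupp \<pi>. ereal \<bar>x1 - x2\<bar>)"

definition ambiguity_set :: "real set \<Rightarrow> real \<Rightarrow> real measure \<Rightarrow> real measure set" where
  "ambiguity_set X r P = {Q \<in> prob_measures X. W_infty X Q P \<le> ereal r}"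

definition quantile :: "real \<Rightarrow> real list \<Rightarrow> real" where
  "quantile p as = sort as ! (nat \<lceil>real (length as) * p\<rceil> - 1)"

definition alpha_DRO :: "real \<Rightarrow> real \<Rightarrow> nat \<Rightarrow> (nat \<Rightarrow> real) \<Rightarrow> real" where
  "alpha_DRO \<delta> r K x = quantile (1 - \<delta>) (map x [1..<Suc K]) + r"

end

theory Submission
  imports Defs
begin

text \<open>
  A bound \<open>r\<close> on the \<open>W\<^sub>\<infinity>\<close>-distance of two laws means that, up to any \<open>\<epsilon> > 0\<close>, they are the
  marginals of one joint law under which the two coordinates almost surely differ by at most
  \<open>r + \<epsilon>\<close>. If one coordinate is at most \<open>q\<close>, the other is then at most \<open>q + r + \<epsilon>\<close>, and letting
  \<open>\<epsilon>\<close> tend to zero (distribution functions are continuous from the right) gives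
  \<open>F\<^sub>1 q \<le> F\<^sub>2 (q + r)\<close> for the two distribution functions, in both orders
  (\<open>W_infty_le_imp_cdf_le\<close>). The empirical law puts mass at least \<open>1 - \<delta>\<close> on the half-line up to
  the \<open>(1 - \<delta>)\<close>-quantile of the sample (\<open>empirical_cdf_quantile\<close>), so every law within distance
  \<open>r\<close> puts at least that mass on the half-line up to the quantile plus \<open>r\<close>.

  This argument works for each realization of the sample separately. It gives the bound over the
  ambiguity set at once; the infimum there is a real infimum, so the set has to be shown nonempty,
  and it contains the empirical law itself. It also shows that the event of being within
  distance \<open>r\<close> of the true law is contained in the event that the inner probability is large
  enough, and the probabilistic claim follows by monotonicity once the larger event is known to be
  measurable.
\<close>

section \<open>Supports and couplings\<close>

lemma space_borel_on [simp]: "space (borel_on X) = X"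
  by (simp add: borel_on_def space_restrict_space)

lemma measurable_id_borel_on [measurable]: "(\<lambda>y. y) \<in> borel_on X \<rightarrow>\<^sub>M borel"
  unfolding borel_on_def by (rule measurable_restrict_space1) simp

lemma atMost_in_sets_borel_on: "{y \<in> X. y \<le> a} \<in> sets (borel_on X)"
proof -
  have "{y \<in> space (borel_on X). y \<le> a} \<in> sets (borel_on X)"
    by measurable
  then show ?thesis by simp
qed

lemma prob_measuresD:
  assumes "P \<in> prob_measures X"
  shows "prob_space P" "sets P = sets (borel_on X)"
  using assms by (auto simp: prob_measures_def space_prob_algebra)

text \<open>The points outside the support are covered by null open sets, and by second countability
  countably many of these suffice.\<close>

lemma AE_msupp:
  fixes \<pi> :: "'a::second_countable_topology measure"
  assumes id: "(\<lambda>z. z) \<in> borel_measurable \<pi>"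
  shows "AE z in \<pi>. z \<in> msupp \<pi>"
proof -
  define \<U> where "\<U> = {U. open U \<and> emeasure \<pi> (U \<inter> space \<pi>) = 0}"
  obtain \<U>' where sub: "\<U>' \<subseteq> \<U>" and cnt: "countable \<U>'" and Un: "\<Union>\<U>' = \<Union>\<U>"
    using Lindelof[of \<U>] unfolding \<U>_def by blast
  have "U \<inter> space \<pi> \<in> null_sets \<pi>" if "U \<in> \<U>'" for U
  proof -
    have "open U" and zero: "emeasure \<pi> (U \<inter> space \<pi>) = 0"
      using that sub by (auto simp: \<U>_def)
    then show ?thesis
      using measurable_sets[OF id, of U] by (auto simp: null_sets_def)
  qed
  then have "(\<Union>U\<in>\<U>'. U \<inter> space \<pi>) \<in> null_sets \<pi>"
    using cnt by (intro null_sets_UN') auto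
  then show ?thesis
  proof (rule AE_I')
    show "{z \<in> space \<pi>. z \<notin> msupp \<pi>} \<subseteq> (\<Union>U\<in>\<U>'. U \<inter> space \<pi>)"
    proof
      fix z assume "z \<in> {z \<in> space \<pi>. z \<notin> msupp \<pi>}"
      then obtain U where "z \<in> space \<pi>" "U \<in> \<U>" "z \<in> U"
        by (auto simp: msupp_def \<U>_def)
      then have "z \<in> \<Union>\<U>'"
        using Un by blast
      with \<open>z \<in> space \<pi>\<close> show "z \<in> (\<Union>U\<in>\<U>'. U \<inter> space \<pi>)"
        by blast
    qed
  qed
qed

lemma couplingsD:
  assumes "\<pi> \<in> couplings X P1 P2"
  shows "prob_space \<pi>" "fst \<in> \<pi> \<rightarrow>\<^sub>M borel_on X" "snd \<in> \<pi> \<rightarrow>\<^sub>M borel_on X"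
    "distr \<pi> (borel_on X) fst = P1" "distr \<pi> (borel_on X) snd = P2"
proof -
  have s: "sets \<pi> = sets (borel_on X \<Otimes>\<^sub>M borel_on X)"
    using assms by (auto simp: couplings_def space_prob_algebra)
  show "prob_space \<pi>" "distr \<pi> (borel_on X) fst = P1" "distr \<pi> (borel_on X) snd = P2"
    using assms by (auto simp: couplings_def space_prob_algebra)
  show "fst \<in> \<pi> \<rightarrow>\<^sub>M borel_on X" "snd \<in> \<pi> \<rightarrow>\<^sub>M borel_on X"
    by (simp_all add: measurable_cong_sets[OF s refl])
qed

text \<open>The slack \<open>r < s\<close> stands in for the existence of an optimal coupling, which would take a
  compactness argument. Since the support has full measure, a bound on it holds almost surely.\<close>

lemma W_infty_le_imp_coupling:
  assumes W: "W_infty X P1 P2 \<le> ereal r" and "r < s"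
  obtains \<pi> where "\<pi> \<in> couplings X P1 P2" "AE z in \<pi>. \<bar>fst z - snd z\<bar> \<le> s"
proof -
  have "W_infty X P1 P2 < ereal s"
    using W \<open>r < s\<close> by (meson less_ereal.simps(1) order_le_less_trans)
  then obtain \<pi> where \<pi>: "\<pi> \<in> couplings X P1 P2"
    and sup: "(SUP (x1, x2)\<in>msupp \<pi>. ereal \<bar>x1 - x2\<bar>) < ereal s"
    unfolding W_infty_def by (auto simp: INF_less_iff)
  note [measurable] = couplingsD(2,3)[OF \<pi>]
  have "(\<lambda>z. (fst z, snd z)) \<in> borel_measurable \<pi>"
    by measurable
  then have "AE z in \<pi>. z \<in> msupp \<pi>"
    by (intro AE_msupp) simp
  then have "AE z in \<pi>. \<bar>fst z - snd z\<bar> \<le> s"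
  proof (rule AE_mp, intro AE_I2 impI)
    fix z assume "z \<in> msupp \<pi>"
    then have "ereal \<bar>fst z - snd z\<bar> \<le> (SUP (x1, x2)\<in>msupp \<pi>. ereal \<bar>x1 - x2\<bar>)"
      by (intro SUP_upper2[of z]) (auto simp: case_prod_beta)
    also note sup
    finally show "\<bar>fst z - snd z\<bar> \<le> s"
      by simp
  qed
  with \<pi> show thesis by (rule that)
qed

section \<open>Comparing distribution functions\<close>

lemma cdf_le_of_AE_dist_le:
  fixes f g :: "'a \<Rightarrow> real"
  assumes "prob_space \<pi>" and f: "f \<in> \<pi> \<rightarrow>\<^sub>M borel_on X" and g: "g \<in> \<pi> \<rightarrow>\<^sub>M borel_on X"
    and ae: "AE z in \<pi>. \<bar>f z - g z\<bar> \<le> s"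
  shows "\<P>(y in distr \<pi> (borel_on X) f. y \<le> q) \<le> \<P>(y in distr \<pi> (borel_on X) g. y \<le> q + s)"
proof -
  interpret prob_space \<pi> by fact
  have prob_distr: "\<P>(y in distr \<pi> (borel_on X) h. y \<le> a) = \<P>(z in \<pi>. h z \<le> a)"
    if [measurable]: "h \<in> \<pi> \<rightarrow>\<^sub>M borel_on X" for h a
    by (subst measure_distr)
       (auto simp: atMost_in_sets_borel_on intro!: arg_cong[where f = "measure \<pi>"] dest: measurable_space[OF that])
  note [measurable] = f g
  have "\<P>(z in \<pi>. f z \<le> q) \<le> \<P>(z in \<pi>. g z \<le> q + s)"
    using ae by (intro finite_measure_mono_AE) (auto elim!: AE_mp)
  then show ?thesis
    by (simp only: prob_distr[OF f] prob_distr[OF g])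
qed

lemma cdf_right_limit:
  fixes P :: "real measure"
  assumes "finite_measure P" and id [measurable]: "(\<lambda>y. y) \<in> borel_measurable P"
    and bound: "\<And>s. a < s \<Longrightarrow> c \<le> \<P>(y in P. y \<le> s)"
  shows "c \<le> \<P>(y in P. y \<le> a)"
proof -
  interpret finite_measure P by fact
  define A where "A n = {y \<in> space P. y \<le> a + inverse (real (Suc n))}" for n
  have "decseq A"
    unfolding A_def decseq_def by (auto elim!: order_trans intro!: le_imp_inverse_le)
  moreover have "range A \<subseteq> sets P"
    unfolding A_def by auto
  ultimately have lim: "(\<lambda>n. measure P (A n)) \<longlonglongrightarrow> measure P (\<Inter>n. A n)"
    by (intro finite_Lim_measure_decseq)
  have "y \<le> a" if "\<And>n. y \<le> a + inverse (real (Suc n))" for y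
    by (rule LIMSEQ_le_const[OF LIMSEQ_inverse_real_of_nat_add]) (use that in auto)
  moreover have "0 \<le> inverse (real (Suc n))" for n
    by simp
  ultimately have "(\<Inter>n. A n) = {y \<in> space P. y \<le> a}"
    unfolding A_def by (auto intro: add_increasing2)
  moreover have "c \<le> measure P (A n)" for n
    unfolding A_def by (rule bound) simp
  ultimately show ?thesis
    using lim by (metis LIMSEQ_le_const)
qed

lemma W_infty_le_imp_cdf_le:
  assumes W: "W_infty X P1 P2 \<le> ereal r"
  shows "\<P>(y in P1. y \<le> q) \<le> \<P>(y in P2. y \<le> q + r)"
    and "\<P>(y in P2. y \<le> q) \<le> \<P>(y in P1. y \<le> q + r)"
proof -
  obtain \<pi> where \<pi>: "\<pi> \<in> couplings X P1 P2"
    using W_infty_le_imp_coupling[OF W, of "r + 1"] by auto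
  have marginals: "finite_measure P1" "finite_measure P2"
      "(\<lambda>y. y) \<in> borel_measurable P1" "(\<lambda>y. y) \<in> borel_measurable P2"
    using couplingsD[OF \<pi>]
    by (auto intro!: prob_space.finite_measure prob_space.prob_space_distr
        simp flip: couplingsD(4,5)[OF \<pi>])
  have slack: "\<P>(y in P1. y \<le> q) \<le> \<P>(y in P2. y \<le> s)
      \<and> \<P>(y in P2. y \<le> q) \<le> \<P>(y in P1. y \<le> s)" if "q + r < s" for s
  proof -
    have "r < s - q" using that by simp
    then obtain \<pi> where \<pi>: "\<pi> \<in> couplings X P1 P2"
      and ae: "AE z in \<pi>. \<bar>fst z - snd z\<bar> \<le> s - q"
      by (rule W_infty_le_imp_coupling[OF W])
    have ae': "AE z in \<pi>. \<bar>snd z - fst z\<bar> \<le> s - q"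
      using ae by (simp add: abs_minus_commute)
    note c = couplingsD[OF \<pi>]
    show ?thesis
      using cdf_le_of_AE_dist_le[OF c(1,2,3) ae, of q] cdf_le_of_AE_dist_le[OF c(1,3,2) ae', of q]
      by (simp add: c(4,5))
  qed
  show "\<P>(y in P1. y \<le> q) \<le> \<P>(y in P2. y \<le> q + r)"
    by (rule cdf_right_limit[OF marginals(2,4) conjunct1[OF slack]])
  show "\<P>(y in P2. y \<le> q) \<le> \<P>(y in P1. y \<le> q + r)"
    by (rule cdf_right_limit[OF marginals(1,3) conjunct2[OF slack]])
qed

section \<open>Order statistics\<close>

text \<open>Comparing an order statistic with a level is the same as counting the entries up to that
  level. This gives both the mass that the empirical law puts up to its quantile and the
  measurability of the quantile.\<close>

lemma sort_nth_le_iff: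
  fixes xs :: "'a::linorder list"
  assumes "k < length xs"
  shows "sort xs ! k \<le> a \<longleftrightarrow> k < length (filter (\<lambda>y. y \<le> a) xs)"
proof -
  define ys where "ys = sort xs"
  have ys: "sorted ys" "k < length ys"
    using assms by (simp_all add: ys_def)
  have "length (filter (\<lambda>y. y \<le> a) xs) = length (filter (\<lambda>y. y \<le> a) ys)"
    unfolding ys_def by (metis mset_filter mset_sort size_mset)
  also have "\<dots> = card {i. i < length ys \<and> ys ! i \<le> a}"
    by (rule length_filter_conv_card)
  finally have len: "length (filter (\<lambda>y. y \<le> a) xs) = card {i. i < length ys \<and> ys ! i \<le> a}" .
  have "ys ! k \<le> a \<longleftrightarrow> k < card {i. i < length ys \<and> ys ! i \<le> a}"
  proof
    assume "ys ! k \<le> a"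
    then have "{..k} \<subseteq> {i. i < length ys \<and> ys ! i \<le> a}"
      using ys by (auto intro: order_trans[OF sorted_nth_mono])
    from card_mono[OF _ this] show "k < card {i. i < length ys \<and> ys ! i \<le> a}"
      by simp
  next
    assume k: "k < card {i. i < length ys \<and> ys ! i \<le> a}"
    show "ys ! k \<le> a"
    proof (rule ccontr)
      assume above: "\<not> ys ! k \<le> a"
      have "{i. i < length ys \<and> ys ! i \<le> a} \<subseteq> {..<k}"
      proof safe
        fix i assume "i < length ys" "ys ! i \<le> a"
        show "i < k"
        proof (rule ccontr)
          assume "\<not> i < k"
          then have "ys ! k \<le> ys ! i"
            using ys(1) \<open>i < length ys\<close> by (intro sorted_nth_mono) simp_all
          also note \<open>ys ! i \<le> a\<close>
          finally show False using above by contradiction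
        qed
      qed
      from card_mono[OF _ this] k show False
        by simp
    qed
  qed
  then show ?thesis
    by (simp add: len flip: ys_def)
qed

lemma quantile_le_iff:
  assumes "0 < p" "p \<le> 1" "as \<noteq> []"
  shows "quantile p as \<le> a \<longleftrightarrow> real (length as) * p \<le> real (length (filter (\<lambda>y. y \<le> a) as))"
proof -
  define m where "m = nat \<lceil>real (length as) * p\<rceil>"
  have pos: "0 < real (length as) * p"
    using assms by simp
  have "real (length as) * p \<le> real (length as)"
    using assms by (simp add: mult_left_le)
  then have "1 \<le> m" "m \<le> length as"
    using pos unfolding m_def by linarith+
  then have "quantile p as \<le> a \<longleftrightarrow> m \<le> length (filter (\<lambda>y. y \<le> a) as)"
    unfolding quantile_def m_def[symmetric] by (subst sort_nth_le_iff) auto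
  also have "\<dots> \<longleftrightarrow> real (length as) * p \<le> real (length (filter (\<lambda>y. y \<le> a) as))"
    unfolding m_def by linarith
  finally show ?thesis .
qed

lemma sample_quantile_le_iff:
  assumes "0 < p" "p \<le> 1" "K \<ge> 1"
  shows "quantile p (map x [1..<Suc K]) \<le> a
    \<longleftrightarrow> real K * p \<le> (\<Sum>i\<in>{1..K}. if x i \<le> a then 1 else 0)"
proof -
  have "length (filter (\<lambda>y. y \<le> a) (map x [1..<Suc K]))
      = card (set (filter (\<lambda>i. x i \<le> a) [1..<Suc K]))"
    by (subst distinct_card) (simp_all add: filter_map o_def del: upt_Suc)
  also have "set (filter (\<lambda>i. x i \<le> a) [1..<Suc K]) = {i \<in> {1..K}. x i \<le> a}"
    by auto
  also have "real (card \<dots>) = (\<Sum>i\<in>{1..K}. if x i \<le> a then 1 else 0)"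
    by (simp add: sum.If_cases Int_def)
  finally show ?thesis
    using assms by (subst quantile_le_iff) (simp_all del: upt_Suc)
qed

lemma measurable_sample_quantile:
  assumes "0 < p" "p \<le> 1" "K \<ge> 1"
  shows "(\<lambda>x. quantile p (map x [1..<Suc K])) \<in> borel_measurable (\<Pi>\<^sub>M i\<in>{1..K}. borel_on X)"
proof (subst borel_measurable_iff_le, intro allI)
  fix a
  have [measurable]: "(\<lambda>x. x i) \<in> borel_measurable (\<Pi>\<^sub>M i\<in>{1..K}. borel_on X)"
    if "i \<in> {1..K}" for i
    by (rule measurable_compose[OF measurable_component_singleton[OF that] measurable_id_borel_on])
  show "{x \<in> space (\<Pi>\<^sub>M i\<in>{1..K}. borel_on X). quantile p (map x [1..<Suc K]) \<le> a}
      \<in> sets (\<Pi>\<^sub>M i\<in>{1..K}. borel_on X)"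
    unfolding sample_quantile_le_iff[OF assms] by measurable
qed

section \<open>The empirical law\<close>

lemma sets_empirical: "sets (empirical X K x) = sets (borel_on X)"
  unfolding empirical_def
  using sets.sigma_sets_eq[of "borel_on X"] sets.space_closed[of "borel_on X"]
  by (simp add: sets_measure_of)

lemma space_empirical: "space (empirical X K x) = X"
  using sets_eq_imp_space_eq[OF sets_empirical] by simp

lemma measure_empirical:
  assumes x: "x \<in> {1..K} \<rightarrow> X" and "K \<ge> 1" and A: "A \<in> sets (borel_on X)"
  shows "measure (empirical X K x) A = (\<Sum>i\<in>{1..K}. indicator A (x i)) / real K"
proof -
  have "emeasure (empirical X K x) A = (\<Sum>i\<in>{1..K}. ennreal (indicator A (x i))) / ennreal (real K)"
    using A by (simp add: emeasure_empirical ennreal_indicator ennreal_of_nat_eq_real_of_nat)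
  also have "\<dots> = ennreal ((\<Sum>i\<in>{1..K}. indicator A (x i)) / real K)"
    using \<open>K \<ge> 1\<close> by (simp add: sum_nonneg divide_ennreal)
  finally show ?thesis
    by (simp add: measure_def sum_nonneg)
qed

lemma empirical_in_prob_measures:
  assumes x: "x \<in> {1..K} \<rightarrow> X" and "K \<ge> 1"
  shows "empirical X K x \<in> prob_measures X"
proof -
  have "measure (empirical X K x) X = (\<Sum>i\<in>{1..K}. indicator X (x i)) / real K"
    using sets.top[of "borel_on X"] assms by (intro measure_empirical) auto
  also have "(\<Sum>i\<in>{1..K}. indicator X (x i) :: real) = (\<Sum>i\<in>{1..K}. 1)"
    using x by (intro sum.cong) (auto simp: Pi_iff)
  finally have "measure (empirical X K x) X = 1"
    using \<open>K \<ge> 1\<close> by simp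
  \<comment> \<open>The value of \<open>measure\<close> is \<open>0\<close> where the extended measure is infinite, so \<open>1\<close> is the true mass.\<close>
  then have "emeasure (empirical X K x) X = 1"
    by (metis emeasure_eq_ennreal_measure ennreal_1 infinity_ennreal_def measure_zero_top zero_neq_one)
  then have "prob_space (empirical X K x)"
    by (intro prob_spaceI) (simp add: space_empirical)
  then show ?thesis
    by (simp add: prob_measures_def space_prob_algebra sets_empirical)
qed

lemma empirical_cdf_quantile:
  assumes x: "x \<in> {1..K} \<rightarrow> X" and K: "K \<ge> 1" and p: "0 < p" "p \<le> 1"
  shows "p \<le> \<P>(y in empirical X K x. y \<le> quantile p (map x [1..<Suc K]))"
proof -
  let ?q = "quantile p (map x [1..<Suc K])"
  let ?A = "{y \<in> X. y \<le> ?q}"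
  have "measure (empirical X K x) ?A = (\<Sum>i\<in>{1..K}. indicator ?A (x i)) / real K"
    by (rule measure_empirical[OF x K atMost_in_sets_borel_on])
  also have "(\<Sum>i\<in>{1..K}. indicator ?A (x i) :: real) = (\<Sum>i\<in>{1..K}. if x i \<le> ?q then 1 else 0)"
    using x by (intro sum.cong) (auto simp: Pi_iff)
  finally have "measure (empirical X K x) ?A = (\<Sum>i\<in>{1..K}. if x i \<le> ?q then 1 else 0) / real K" .
  moreover have "real K * p \<le> (\<Sum>i\<in>{1..K}. if x i \<le> ?q then 1 else 0)"
    using sample_quantile_le_iff[OF p K, of x ?q] by blast
  ultimately show ?thesis
    using K by (simp add: space_empirical pos_le_divide_eq mult.commute del: upt_Suc)
qed

text \<open>The law of \<open>(Y, Y)\<close> with \<open>Y\<close> distributed according to \<open>P\<close> is a coupling, and its support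
  lies in the diagonal because the diagonal is closed.\<close>

lemma W_infty_self:
  assumes P: "P \<in> prob_measures X"
  shows "W_infty X P P \<le> 0"
proof -
  note P' = prob_measuresD[OF P]
  define \<pi> where "\<pi> = distr P (borel_on X \<Otimes>\<^sub>M borel_on X) (\<lambda>y. (y, y))"
  have id: "(\<lambda>y. y) \<in> P \<rightarrow>\<^sub>M borel_on X"
    by (simp add: measurable_cong_sets[OF P'(2) refl])
  then have diag: "(\<lambda>y. (y, y)) \<in> P \<rightarrow>\<^sub>M borel_on X \<Otimes>\<^sub>M borel_on X"
    by simp
  have marginal: "distr P (borel_on X) (\<lambda>y. y) = P"
    by (rule distr_id2) (simp add: P'(2))
  have "prob_space \<pi>"
    unfolding \<pi>_def by (rule prob_space.prob_space_distr[OF P'(1) diag])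
  then have coupling: "\<pi> \<in> couplings X P P"
    by (auto simp: couplings_def space_prob_algebra \<pi>_def distr_distr[OF measurable_fst diag]
        distr_distr[OF measurable_snd diag] o_def marginal)
  have "x1 = x2" if "(x1, x2) \<in> msupp \<pi>" for x1 x2
  proof (rule ccontr)
    assume "x1 \<noteq> x2"
    then obtain U V where UV: "open U" "open V" "x1 \<in> U" "x2 \<in> V" "U \<inter> V = {}"
      using hausdorff by metis
    have sp: "space \<pi> = X \<times> X"
      by (simp add: \<pi>_def space_pair_measure)
    have "(U \<inter> X) \<times> (V \<inter> X) \<in> sets (borel_on X \<Otimes>\<^sub>M borel_on X)"
      using UV unfolding borel_on_def by (intro pair_measureI) (auto simp: sets_restrict_space)
    then have "emeasure \<pi> ((U \<inter> X) \<times> (V \<inter> X))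
        = emeasure P ((\<lambda>y. (y, y)) -` ((U \<inter> X) \<times> (V \<inter> X)) \<inter> space P)"
      unfolding \<pi>_def by (rule emeasure_distr[OF diag])
    also have "(\<lambda>y. (y, y)) -` ((U \<inter> X) \<times> (V \<inter> X)) \<inter> space P = {}"
      using UV by auto
    finally have "emeasure \<pi> ((U \<times> V) \<inter> space \<pi>) = 0"
      by (simp add: sp Times_Int_Times)
    moreover have "open (U \<times> V)" "(x1, x2) \<in> U \<times> V"
      using UV by (auto intro: open_Times)
    ultimately show False
      using that by (auto simp: msupp_def)
  qed
  then have "(SUP (x1, x2)\<in>msupp \<pi>. ereal \<bar>x1 - x2\<bar>) \<le> 0"
    by (intro SUP_least) auto
  then show ?thesis
    unfolding W_infty_def using coupling by (rule INF_lower2[rotated])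
qed

section \<open>The distributionally robust quantile\<close>

theorem lemma4p7:
  fixes X :: "real set" and P :: "real measure"
    and M :: "'w measure" and R :: "nat \<Rightarrow> 'w \<Rightarrow> real"
    and K :: nat and \<delta> \<beta> r :: real
  assumes "0 < \<delta>" and "\<delta> < 1" and "0 < \<beta>" and "\<beta> < 1" and "K \<ge> 1"
    and "P \<in> prob_measures X"
    and "prob_space M"
    and "prob_space.indep_vars M (\<lambda>_. borel_on X) R {0..K}"
    and "\<forall>i\<in>{0..K}. distr M (borel_on X) (R i) = P"
    and "r > 0"
    and "\<P>(x in sample_law M X K R. W_infty X (empirical X K x) P \<le> ereal r) \<ge> 1 - \<beta>"
  shows "\<P>(x in sample_law M X K R. \<P>(y in P. y \<le> alpha_DRO \<delta> r K x) \<ge> 1 - \<delta>) \<ge> 1 - \<beta>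
    \<and> (\<forall>x \<in> {1..K} \<rightarrow> X.
          (INF Q\<in>ambiguity_set X r (empirical X K x). \<P>(y in Q. y \<le> alpha_DRO \<delta> r K x)) \<ge> 1 - \<delta>)"
proof (intro conjI ballI)
  interpret M: prob_space M by fact
  let ?N = "sample_law M X K R"
  let ?W = "{x \<in> space ?N. W_infty X (empirical X K x) P \<le> ereal r}"
  let ?G = "{x \<in> space ?N. \<P>(y in P. y \<le> alpha_DRO \<delta> r K x) \<ge> 1 - \<delta>}"
  have p: "0 < 1 - \<delta>" "1 - \<delta> \<le> 1"
    using assms(1,2) by auto
  have "(\<lambda>\<omega>. \<lambda>i\<in>{1..K}. R i \<omega>) \<in> M \<rightarrow>\<^sub>M (\<Pi>\<^sub>M i\<in>{1..K}. borel_on X)"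
    using assms(8) by (intro measurable_restrict) (auto simp: M.indep_vars_def)
  then interpret N: prob_space ?N
    unfolding sample_law_def by (rule M.prob_space_distr)
  have sets_N: "sets ?N = sets (\<Pi>\<^sub>M i\<in>{1..K}. borel_on X)"
    by (simp add: sample_law_def)
  have sample_in: "x \<in> {1..K} \<rightarrow> X" if "x \<in> space ?N" for x
    using that sets_eq_imp_space_eq[OF sets_N] by (auto simp: space_PiM)

  interpret P: prob_space P
    using assms(6) by (rule prob_measuresD)
  have [measurable]: "(\<lambda>y. y) \<in> borel_measurable P"
    by (simp add: measurable_cong_sets[OF prob_measuresD(2)[OF assms(6)] refl])
  have "(\<lambda>x. alpha_DRO \<delta> r K x) \<in> borel_measurable ?N"
    unfolding alpha_DRO_def measurable_cong_sets[OF sets_N refl]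
    using measurable_sample_quantile[OF p assms(5)] by simp
  moreover have "(\<lambda>a. \<P>(y in P. y \<le> a)) \<in> borel_measurable borel"
    by (intro borel_measurable_mono monoI P.finite_measure_mono) auto
  ultimately have [measurable]: "(\<lambda>x. \<P>(y in P. y \<le> alpha_DRO \<delta> r K x)) \<in> borel_measurable ?N"
    by (rule measurable_compose)
  have "?G \<in> sets ?N"
    by measurable
  moreover have "?W \<subseteq> ?G"
  proof safe
    fix x assume "x \<in> space ?N" and W: "W_infty X (empirical X K x) P \<le> ereal r"
    have "1 - \<delta> \<le> \<P>(y in empirical X K x. y \<le> quantile (1 - \<delta>) (map x [1..<Suc K]))"
      by (rule empirical_cdf_quantile[OF sample_in[OF \<open>x \<in> space ?N\<close>] assms(5) p])
    also have "\<dots> \<le> \<P>(y in P. y \<le> alpha_DRO \<delta> r K x)"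
      unfolding alpha_DRO_def by (rule W_infty_le_imp_cdf_le(1)[OF W])
    finally show "1 - \<delta> \<le> \<P>(y in P. y \<le> alpha_DRO \<delta> r K x)" .
  qed
  ultimately have "measure ?N ?W \<le> measure ?N ?G"
    by (intro N.finite_measure_mono)
  with assms(11) show "measure ?N ?G \<ge> 1 - \<beta>"
    by linarith

  fix x assume x: "x \<in> {1..K} \<rightarrow> X"
  have "W_infty X (empirical X K x) (empirical X K x) \<le> ereal r"
    using W_infty_self[OF empirical_in_prob_measures[OF x assms(5)]] \<open>r > 0\<close>
    by (auto elim: order_trans)
  then have "empirical X K x \<in> ambiguity_set X r (empirical X K x)"
    using empirical_in_prob_measures[OF x assms(5)] by (simp add: ambiguity_set_def)
  then show "(INF Q\<in>ambiguity_set X r (empirical X K x). \<P>(y in Q. y \<le> alpha_DRO \<delta> r K x)) \<ge> 1 - \<delta>"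
  proof (intro cINF_greatest)
    fix Q assume "Q \<in> ambiguity_set X r (empirical X K x)"
    then have W: "W_infty X Q (empirical X K x) \<le> ereal r"
      by (simp add: ambiguity_set_def)
    have "1 - \<delta> \<le> \<P>(y in empirical X K x. y \<le> quantile (1 - \<delta>) (map x [1..<Suc K]))"
      by (rule empirical_cdf_quantile[OF x assms(5) p])
    also have "\<dots> \<le> \<P>(y in Q. y \<le> alpha_DRO \<delta> r K x)"
      unfolding alpha_DRO_def by (rule W_infty_le_imp_cdf_le(2)[OF W])
    finally show "1 - \<delta> \<le> \<P>(y in Q. y \<le> alpha_DRO \<delta> r K x)" .
  qed auto
qed

end
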